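(* Let $a,b \in \mathbb{Z}$ with $a \geq 1$ and $1-a < b < 1+a$, and let $k = \frac{a + \sqrt{a^2 + 4b}}{2}$. Then the row-length sequence $(r_d)_{d \ge 0}$ of the $k$-descending tree satisfies the linear recurrence $$r_d = a\cdot r_{d-1} + b \cdot r_{d-2} \quad \text{for all } d \ge 2,$$ with base case $r_0 = 1$, $r_1 = \lceil k\rceil-1$.
   Context: $\mathbb{N}$ denotes the non-negative integers. For real $k>1$, the $k$-descending tree (or $k$-tree) is the rooted tree with node set $\mathbb{N}$ and root $0$, in which every positive integer $n$ has parent $\lfloor n/k \rfloor$. For a node $n\in\mathbb{N}$, let $g_0 = n$ and $g_{i+1} = \lfloor g_i/k \rfloor$; then $\mathrm{depth}(n) = \min\{i \ge 0 : g_i = 0\}$, and $r_d = |\{n \in \mathbb{N} : \mathrm{depth}(n) = d\}|$ for $d \ge 0$ is the number of nodes at depth $d$. *)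

theory Defs
  imports Complex_Main
begin

text \<open>
  For \<open>k > 1\<close>, the \<open>k\<close>-descending tree has node set \<open>nat\<close> and root \<open>0\<close>. The map
  \<open>parent k\<close> is extended by the same formula to the root, which it fixes.
\<close>

definition parent :: "real \<Rightarrow> nat \<Rightarrow> nat" where
  "parent k n = nat \<lfloor>real n / k\<rfloor>"

definition depth :: "real \<Rightarrow> nat \<Rightarrow> nat" where
  "depth k n = (LEAST i. (parent k ^^ i) n = 0)"

definition row_length :: "real \<Rightarrow> nat \<Rightarrow> nat" where
  "row_length k d = card {n. depth k n = d}"

text \<open>
  For \<open>k > 1\<close> the \<open>LEAST\<close> ranges over a nonempty set and every row is finite, so that
  neither \<open>depth\<close> nor \<open>row_length\<close> takes a junk value.
\<close>

lemma parent_less: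
  assumes "k > 1" "n > 0"
  shows "parent k n < n"
proof -
  have "real n / k < real n"
    using assms by (simp add: divide_less_eq)
  then have "\<lfloor>real n / k\<rfloor> < int n"
    by (simp add: floor_less_iff)
  then show ?thesis
    using assms by (simp add: parent_def)
qed

lemma parent_reaches_root:
  assumes "k > 1"
  shows "\<exists>i. (parent k ^^ i) n = 0"
proof (induction n rule: less_induct)
  case (less n)
  show ?case
  proof (cases "n = 0")
    case True
    then have "(parent k ^^ 0) n = 0" by simp
    then show ?thesis by blast
  next
    case False
    then obtain i where "(parent k ^^ i) (parent k n) = 0"
      using less parent_less[OF assms] by blast
    then have "(parent k ^^ Suc i) n = 0"
      by (simp only: funpow_Suc_right o_apply)
    then show ?thesis by blast
  qed
qed

lemma finite_parent_vimage:
  assumes "k > 1" "finite A"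
  shows "finite {n. parent k n \<in> A}"
proof -
  obtain m where m: "\<forall>x\<in>A. x \<le> m"
    using assms(2) unfolding finite_nat_set_iff_bounded_le ..
  have "n \<le> nat \<lceil>(real m + 1) * k\<rceil>" if "parent k n \<in> A" for n
  proof -
    have "parent k n \<le> m"
      using m that ..
    then have "\<lfloor>real n / k\<rfloor> \<le> int m"
      unfolding parent_def by linarith
    then have "real n / k < real m + 1" by linarith
    then have "real n < (real m + 1) * k"
      using assms(1) by (simp add: divide_less_eq)
    also have "\<dots> \<le> real (nat \<lceil>(real m + 1) * k\<rceil>)"
      by (rule real_nat_ceiling_ge)
    finally show ?thesis by simp
  qed
  then have "{n. parent k n \<in> A} \<subseteq> {..nat \<lceil>(real m + 1) * k\<rceil>}"
    by auto
  then show ?thesis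
    by (rule finite_subset) (rule finite_atMost)
qed

lemma finite_row:
  assumes "k > 1"
  shows "finite {n. depth k n = d}"
proof -
  have "finite {n. (parent k ^^ i) n = 0}" for i
  proof (induction i)
    case (Suc i)
    have "{n. (parent k ^^ Suc i) n = 0} = {n. parent k n \<in> {n. (parent k ^^ i) n = 0}}"
      by (simp only: funpow_Suc_right o_apply mem_Collect_eq)
    then show ?case
      using finite_parent_vimage[OF assms Suc] by simp
  qed simp
  moreover have "(parent k ^^ depth k n) n = 0" for n
    unfolding depth_def by (rule LeastI_ex[OF parent_reaches_root[OF assms]])
  then have "{n. depth k n = d} \<subseteq> {n. (parent k ^^ d) n = 0}"
    by auto
  ultimately show ?thesis
    using finite_subset by blast
qed

end

theory Submission
  imports Defs
begin

text \<open>
  The nodes of depth at most \<open>d\<close> form an initial segment \<open>{..<N d}\<close> with \<open>N 0 = 1\<close> and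
  \<open>N (d + 1) = \<lceil>k * N d\<rceil>\<close>. Put \<open>j = k - a\<close>, the negative of the conjugate root, so that
  \<open>k * j = b\<close> and \<open>\<bar>j\<bar> < 1\<close>. If \<open>N (d + 1) = k * N d + e\<close> with \<open>0 \<le> e < 1\<close>, then
  \<open>N (d + 2) = \<lceil>(a + j) * N (d + 1)\<rceil> = a * N (d + 1) + b * N d + \<lceil>j * e\<rceil>\<close>,
  and \<open>\<lceil>j * e\<rceil> = \<lceil>j\<rceil>\<close> does not depend on \<open>d\<close>; for \<open>j > 0\<close> this needs \<open>e \<noteq> 0\<close>, which is
  the irrationality of \<open>k\<close>. Taking differences removes the constant.
\<close>

primrec level_bound :: "real \<Rightarrow> nat \<Rightarrow> nat" where
  "level_bound k 0 = 1"
| "level_bound k (Suc d) = nat \<lceil>k * real (level_bound k d)\<rceil>"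

lemma parent_0 [simp]: "parent k 0 = 0"
  by (simp add: parent_def)

lemma funpow_parent_0 [simp]: "(parent k ^^ i) 0 = 0"
  by (induction i) auto

text \<open>The root is a fixed point of \<open>parent k\<close>, so an orbit that has reached
  \<open>0\<close> stays there and the single iterate \<open>d\<close> decides.\<close>

lemma depth_le_iff:
  assumes "k > 1"
  shows "depth k n \<le> d \<longleftrightarrow> (parent k ^^ d) n = 0"
proof
  assume le: "depth k n \<le> d"
  have "(parent k ^^ depth k n) n = 0"
    unfolding depth_def by (rule LeastI_ex[OF parent_reaches_root[OF assms]])
  then have "(parent k ^^ (d - depth k n + depth k n)) n = 0"
    by (simp only: funpow_add o_apply funpow_parent_0)
  then show "(parent k ^^ d) n = 0"
    using le by simp
next
  assume "(parent k ^^ d) n = 0"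
  then show "depth k n \<le> d"
    unfolding depth_def by (rule Least_le)
qed

text \<open>Floor and ceiling drop out of strict comparisons with integers. So the preimage of an
  initial segment under \<open>parent k\<close> is again an initial segment, and its length is the
  recursion step of \<open>level_bound\<close>.\<close>

lemma parent_less_iff:
  assumes "k > 0"
  shows "parent k n < m \<longleftrightarrow> n < nat \<lceil>k * real m\<rceil>"
proof -
  have "parent k n < m \<longleftrightarrow> \<lfloor>real n / k\<rfloor> < int m"
    using assms by (simp add: parent_def nat_less_iff)
  also have "\<dots> \<longleftrightarrow> real n < k * real m"
    using assms by (simp add: floor_less_iff divide_less_eq mult.commute)
  also have "\<dots> \<longleftrightarrow> n < nat \<lceil>k * real m\<rceil>"
    by (simp add: zless_nat_eq_int_zless less_ceiling_iff)
  finally show ?thesis .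
qed

lemma depth_le_iff_less_level_bound:
  assumes "k > 1"
  shows "depth k n \<le> d \<longleftrightarrow> n < level_bound k d"
proof -
  have "(parent k ^^ d) n = 0 \<longleftrightarrow> n < level_bound k d"
  proof (induction d arbitrary: n)
    case (Suc d)
    have "(parent k ^^ Suc d) n = 0 \<longleftrightarrow> parent k n < level_bound k d"
      by (simp only: funpow_Suc_right o_apply Suc)
    then show ?case
      using assms by (simp add: parent_less_iff)
  qed simp
  then show ?thesis
    by (simp add: depth_le_iff[OF assms])
qed

lemma level_bound_pos:
  assumes "k > 1"
  shows "level_bound k d > 0"
  using assms by (induction d) (simp_all)

lemma level_bound_mono:
  assumes "k > 1"
  shows "level_bound k d \<le> level_bound k (Suc d)"
proof -
  have "1 * real (level_bound k d) \<le> k * real (level_bound k d)"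
    using assms by (intro mult_right_mono) auto
  then show ?thesis
    by simp linarith
qed

lemma row_length_0:
  assumes "k > 1"
  shows "row_length k 0 = 1"
proof -
  have "{n. depth k n = 0} = {..<level_bound k 0}"
    using depth_le_iff_less_level_bound[OF assms, of _ 0] by auto
  then show ?thesis
    by (simp add: row_length_def)
qed

lemma row_length_Suc:
  assumes "k > 1"
  shows "int (row_length k (Suc d)) = int (level_bound k (Suc d)) - int (level_bound k d)"
proof -
  have "depth k n = Suc d \<longleftrightarrow> level_bound k d \<le> n \<and> n < level_bound k (Suc d)" for n
    using depth_le_iff_less_level_bound[OF assms, of n d]
      depth_le_iff_less_level_bound[OF assms, of n "Suc d"] by linarith
  then have "row_length k (Suc d) = level_bound k (Suc d) - level_bound k d"
    by (simp only: row_length_def atLeastLessThan_iff[symmetric] Collect_mem_eq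
        card_atLeastLessThan)
  then show ?thesis
    \<comment> \<open>Monotonicity makes the truncated subtraction on \<open>nat\<close>
      exact.\<close>
    using of_nat_diff[OF level_bound_mono[OF assms]] by (simp only:)
qed

text \<open>Infinite descent: if \<open>k * n\<close> is an integer, then \<open>n' = (k - a) * n\<close> is a smaller positive
  integer, and \<open>k * n' = b * n\<close> is again an integer.\<close>

lemma quadratic_root_times_nat_not_Ints:
  fixes a b :: int and k :: real and n :: nat
  assumes "0 < k - a" "k - a < 1" "k * (k - a) = b" "n > 0"
  shows "k * n \<notin> \<int>"
  using \<open>n > 0\<close>
proof (induction n rule: less_induct)
  case (less n)
  show ?case
  proof
    assume "k * n \<in> \<int>"
    then obtain m where m: "k * n = of_int m"
      by (auto elim: Ints_cases)
    define n' where "n' = nat (m - a * int n)"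
    have eq: "of_int (m - a * int n) = (k - a) * n"
      using m by (simp add: algebra_simps)
    have "0 < (k - a) * n" "(k - a) * n < n"
      using assms(1,2) less.prems by simp_all
    with eq have pos: "0 < m - a * int n" and "m - a * int n < int n"
      by linarith+
    then have "0 < n'" "n' < n"
      by (simp_all add: n'_def)
    have "real n' = of_int (m - a * int n)"
      using pos unfolding n'_def by (intro of_nat_nat) simp
    then have "k * n' = k * (k - a) * n"
      by (simp only: eq mult.assoc)
    also have "\<dots> = of_int (b * int n)"
      by (simp add: assms(3))
    finally have "k * n' = of_int (b * int n)" .
    then have "k * n' \<in> \<int>"
      by (metis Ints_of_int)
    then show False
      using less.IH[of n'] \<open>0 < n'\<close> \<open>n' < n\<close> by blast
  qed
qed

text \<open>Multiplying by \<open>e\<close> keeps \<open>j\<close> inside \<open>(0, 1]\<close> if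
  \<open>j > 0\<close> and inside \<open>(-1, 0]\<close> otherwise; the ceiling is constant on each
  of these intervals.\<close>

lemma ceiling_mult_unit:
  fixes j e :: real
  assumes "-1 < j" "j < 1" "0 \<le> e" "e < 1" "j > 0 \<Longrightarrow> e > 0"
  shows "\<lceil>j * e\<rceil> = \<lceil>j\<rceil>"
proof (cases "j > 0")
  case True
  then have "0 < j * e" "j * e < 1"
    using assms mult_strict_mono[of j 1 e 1] by auto
  then have "\<lceil>j * e\<rceil> = 1" "\<lceil>j\<rceil> = 1"
    using True assms by (auto simp: ceiling_eq_iff)
  then show ?thesis
    by simp
next
  case False
  have "(- j) * e \<le> 1 * e"
    using assms by (intro mult_right_mono) auto
  then have "-1 < j * e" "j * e \<le> 0"
    using assms False by (auto simp: mult_nonpos_nonneg)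
  then have "\<lceil>j * e\<rceil> = 0" "\<lceil>j\<rceil> = 0"
    using False assms by (auto simp: ceiling_eq_iff)
  then show ?thesis
    by simp
qed

lemma level_bound_rec:
  fixes a b :: int and k :: real
  assumes k: "k > 1" and j: "-1 < k - a" "k - a < 1" and kj: "k * (k - a) = b"
  shows "int (level_bound k (Suc (Suc d)))
           = a * int (level_bound k (Suc d)) + b * int (level_bound k d) + \<lceil>k - a\<rceil>"
proof -
  define N where "N = level_bound k d"
  define M where "M = level_bound k (Suc d)"
  define e where "e = M - k * N"
  have "N > 0"
    unfolding N_def using k by (rule level_bound_pos)
  have ceiling: "int (level_bound k (Suc i)) = \<lceil>k * level_bound k i\<rceil>" for i
  proof -
    have "0 \<le> k * level_bound k i"
      using k by simp
    then have "0 \<le> \<lceil>k * level_bound k i\<rceil>"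
      by linarith
    then show ?thesis
      by simp
  qed
  have M: "int M = \<lceil>k * N\<rceil>"
    unfolding M_def N_def by (rule ceiling)
  have M': "real M = of_int \<lceil>k * N\<rceil>"
    by (metis M of_int_of_nat_eq)
  have e: "0 \<le> e" "e < 1"
    unfolding e_def M' by linarith+
  have "e > 0" if "k - a > 0"
  proof -
    have "k * N \<notin> \<int>"
      using quadratic_root_times_nat_not_Ints[OF that j(2) kj \<open>N > 0\<close>] .
    then have "e \<noteq> 0"
      unfolding e_def by (metis Ints_of_nat eq_iff_diff_eq_0)
    then show ?thesis
      using e by simp
  qed
  then have "\<lceil>(k - a) * e\<rceil> = \<lceil>k - a\<rceil>"
    using j e by (intro ceiling_mult_unit) auto
  \<comment> \<open>Split \<open>k * M\<close> as \<open>a * M + (k - a) * M\<close> and insert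
    \<open>M = k * N + e\<close> into the second summand; there \<open>(k - a) * k\<close> is
    \<open>b\<close>.\<close>
  moreover have "k * M = (k - a) * e + of_int (a * int M + b * int N)"
    by (simp add: e_def kj[symmetric] algebra_simps)
  then have "\<lceil>k * M\<rceil> = \<lceil>(k - a) * e\<rceil> + (a * int M + b * int N)"
    by (simp only: ceiling_add_of_int)
  moreover have "int (level_bound k (Suc (Suc d))) = \<lceil>k * M\<rceil>"
    unfolding M_def by (rule ceiling)
  ultimately show ?thesis
    by (simp add: M_def N_def del: level_bound.simps)
qed

lemma quadratic_root_bounds:
  fixes a b :: int and k :: real
  assumes "a \<ge> 1" "1 - a < b" "b < 1 + a"
    and k: "k = (real_of_int a + sqrt (real_of_int a ^ 2 + 4 * real_of_int b)) / 2"
  shows "k > 1" "-1 < k - a" "k - a < 1" "k * (k - a) = b"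
proof -
  define D where "D = real_of_int a ^ 2 + 4 * real_of_int b"
  have b: "1 - real_of_int a < b" "b < 1 + real_of_int a" "real_of_int a \<ge> 1"
    using assms(1-3) by linarith+
  \<comment> \<open>After expanding the squares, these are the lower and the upper bound on
    \<open>b\<close>.\<close>
  have D1: "(real_of_int a - 2)\<^sup>2 < D" and D2: "D < (real_of_int a + 2)\<^sup>2"
    using b by (simp_all add: D_def power2_eq_square algebra_simps)
  have "\<bar>real_of_int a - 2\<bar> < sqrt D"
    using D1 by (intro real_less_rsqrt) simp
  \<comment> \<open>The first claim amounts to \<open>2 - a < sqrt D\<close>, the second to
    \<open>a - 2 < sqrt D\<close>.\<close>
  then show "k > 1" "-1 < k - a"
    by (auto simp: k D_def[symmetric])
  have "sqrt D < a + 2"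
    using D2 b by (intro real_less_lsqrt) auto
  then show "k - a < 1"
    by (simp add: k D_def[symmetric])
  have "D \<ge> 0"
    using D1 by (smt (verit) zero_le_power2)
  then have "(sqrt D)\<^sup>2 = real_of_int a ^ 2 + 4 * real_of_int b"
    by (simp add: D_def)
  then show "k * (k - a) = b"
    by (simp add: k D_def[symmetric] power2_eq_square field_simps)
qed

theorem theorem3:
  fixes a b :: int and k :: real
  assumes "a \<ge> 1"
    and "1 - a < b" and "b < 1 + a"
    and "k = (real_of_int a + sqrt (real_of_int a ^ 2 + 4 * real_of_int b)) / 2"
  shows "(\<forall>d\<ge>2. int (row_length k d)
             = a * int (row_length k (d - 1)) + b * int (row_length k (d - 2)))
         \<and> row_length k 0 = 1
         \<and> int (row_length k 1) = \<lceil>k\<rceil> - 1"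
proof -
  note k = quadratic_root_bounds[OF assms]
  note rec = level_bound_rec[OF k]
  note row = row_length_Suc[OF k(1)] row_length_0[OF k(1)]
  have N1: "int (level_bound k (Suc 0)) = \<lceil>k\<rceil>"
    using k(1) by simp
  have step: "int (row_length k (Suc (Suc d)))
      = a * int (row_length k (Suc d)) + b * int (row_length k d)" for d
  proof (cases d)
    \<comment> \<open>Row \<open>0\<close> is not a difference of level bounds. Here the constant
      does not cancel but is evaluated:
      \<open>\<lceil>k - a\<rceil> = \<lceil>k\<rceil> - a\<close>, where
      \<open>\<lceil>k\<rceil>\<close> is the level bound at \<open>1\<close>.\<close>
    case 0
    then show ?thesis
      using rec[of 0] N1 by (simp add: row algebra_simps del: level_bound.simps(2))
  next
    \<comment> \<open>All three rows are differences, so subtracting consecutive instances of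
      \<open>rec\<close> cancels \<open>\<lceil>k - a\<rceil>\<close>.\<close>
    case (Suc d')
    then show ?thesis
      using rec[of d'] rec[of "Suc d'"] unfolding Suc row right_diff_distrib by linarith
  qed
  have "int (row_length k d)
      = a * int (row_length k (d - 1)) + b * int (row_length k (d - 2))" if "d \<ge> 2" for d
  proof -
    have "d = Suc (Suc (d - 2))" "d - 1 = Suc (d - 2)"
      using that by simp_all
    then show ?thesis
      using step[of "d - 2"] by simp
  qed
  then show ?thesis
    using row(2) row(1)[of 0] N1 by simp
qed

end
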